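(* Let $p$ be a prime and $m\ge 1$ with $p^m\equiv 3 \pmod 4$. Identify $\mathbb{Z}_p^m$ with the additive group of the field $\mathbb{F}_{p^m}$, and let $D=\{x^2 : x\in \mathbb{F}_{p^m}\setminus\{0\}\}$ be the Paley difference set and $D^{(-1)}=\{-x : x\in D\}$. Let $\alpha,\beta$ be nonzero elements of $\mathbb{Z}_p=\mathbb{F}_p$ with $\alpha\neq\beta$. Then the set $$S=\{(0,0)\}\cup\{(x,\alpha x) : x\in D\}\cup\{(x,\beta x) : x\in D^{(-1)}\}\subset \mathbb{F}_{p^m}\times\mathbb{F}_{p^m}$$ is a formally self dual set in the additive group $G=\mathbb{F}_{p^m}\times \mathbb{F}_{p^m}\cong \mathbb{Z}_p^{2m}$.
   Context: For a finite abelian group $G$ with dual group $\hat G$ (homomorphisms $G\to\mathbb{C}^*$), sets $S\subset G$, $T\subset\hat G$ form a formally dual pair if for all $\chi\in\hat G$: $|\chi(S)|^2=\frac{|S|^2}{|T|}\nu_T(\chi)$, where $\chi(S)=\sum_{x\in S}\chi(x)$ and $\nu_T(\chi)=|\{(\phi,\psi)\in T\times T : \phi\psi^{-1}=\chi\}|$. For a group isomorphism $\Delta:G\to\hat G$, sets $S,T\subset G$ form a formally dual pair under $\Delta$ if $S$ and $\Delta(T)$ form a formally dual pair. A set $S\subset G$ is formally self dual if there exists a group isomorphism $\Delta:G\to\hat G$ such that $S$ and $S$ form a formally dual pair under $\Delta$. *)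

theory Defs
  imports Complex_Main "HOL-Algebra.Algebra" "HOL-Computational_Algebra.Primes"
begin

definition complex_units :: "complex monoid" where
  "complex_units = \<lparr>carrier = UNIV - {0}, monoid.mult = (*), one = 1\<rparr>"

(* Characters are functions on the whole type of elements; restricting to extensional ones
   makes two characters equal iff they agree on the carrier of G. *)
definition dual_group :: "('a, 'm) monoid_scheme \<Rightarrow> ('a \<Rightarrow> complex) monoid" where
  "dual_group G =
     \<lparr>carrier = hom G complex_units \<inter> extensional (carrier G),
      monoid.mult = (\<lambda>\<phi> \<psi>. \<lambda>x\<in>carrier G. \<phi> x * \<psi> x),
      one = (\<lambda>x\<in>carrier G. 1)\<rparr>"

lemma comm_group_dual_group:
  fixes G (structure)
  assumes "group G"
  shows "comm_group (dual_group G)"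
proof -
  interpret group G by fact
  show ?thesis
  proof (rule comm_groupI)
    fix \<chi> assume \<chi>: "\<chi> \<in> carrier (dual_group G)"
    have nz: "\<chi> x \<noteq> 0" if "x \<in> carrier G" for x
      using \<chi> that by (auto simp: dual_group_def hom_def complex_units_def)
    have "(\<lambda>x\<in>carrier G. inverse (\<chi> x)) \<in> carrier (dual_group G)"
      using \<chi> by (auto simp: dual_group_def hom_def complex_units_def)
    moreover have "(\<lambda>x\<in>carrier G. inverse (\<chi> x)) \<otimes>\<^bsub>dual_group G\<^esub> \<chi> = \<one>\<^bsub>dual_group G\<^esub>"
      using nz by (auto simp: dual_group_def fun_eq_iff)
    ultimately show "\<exists>\<psi>\<in>carrier (dual_group G). \<psi> \<otimes>\<^bsub>dual_group G\<^esub> \<chi> = \<one>\<^bsub>dual_group G\<^esub>"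
      by blast
  qed (auto simp: dual_group_def hom_def complex_units_def extensional_def fun_eq_iff)
qed

definition diff_count :: "('g, 'm) monoid_scheme \<Rightarrow> 'g set \<Rightarrow> 'g \<Rightarrow> nat" where
  "diff_count H T \<chi> = card {(\<phi>, \<psi>) \<in> T \<times> T. \<phi> \<otimes>\<^bsub>H\<^esub> inv\<^bsub>H\<^esub> \<psi> = \<chi>}"

(* T is required to be nonempty because the defining equation divides by its cardinality. *)
definition formally_dual_pair ::
    "('a, 'm) monoid_scheme \<Rightarrow> 'a set \<Rightarrow> ('a \<Rightarrow> complex) set \<Rightarrow> bool" where
  "formally_dual_pair G S T \<longleftrightarrow>
     comm_group G \<and> finite (carrier G) \<and>
     S \<subseteq> carrier G \<and> T \<subseteq> carrier (dual_group G) \<and> T \<noteq> {} \<and>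
     (\<forall>\<chi>\<in>carrier (dual_group G).
        (cmod (\<Sum>x\<in>S. \<chi> x))\<^sup>2 =
          (real (card S))\<^sup>2 / real (card T) * real (diff_count (dual_group G) T \<chi>))"

definition formally_dual_pair_under ::
    "('a, 'm) monoid_scheme \<Rightarrow> ('a \<Rightarrow> 'a \<Rightarrow> complex) \<Rightarrow> 'a set \<Rightarrow> 'a set \<Rightarrow> bool" where
  "formally_dual_pair_under G \<Delta> S T \<longleftrightarrow>
     \<Delta> \<in> iso G (dual_group G) \<and> S \<subseteq> carrier G \<and> T \<subseteq> carrier G \<and>
     formally_dual_pair G S (\<Delta> ` T)"

definition formally_self_dual :: "('a, 'm) monoid_scheme \<Rightarrow> 'a set \<Rightarrow> bool" where
  "formally_self_dual G S \<longleftrightarrow> (\<exists>\<Delta>. formally_dual_pair_under G \<Delta> S S)"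

definition prime_subfield :: "('a, 'm) ring_scheme \<Rightarrow> 'a set" where
  "prime_subfield R = range (\<lambda>k::int. [k] \<cdot>\<^bsub>R\<^esub> \<one>\<^bsub>R\<^esub>)"

definition paley_set :: "('a, 'm) ring_scheme \<Rightarrow> 'a set" where
  "paley_set R = (\<lambda>x. x [^]\<^bsub>R\<^esub> (2::nat)) ` (carrier R - {\<zero>\<^bsub>R\<^esub>})"

end

theory Submission
  imports Defs
begin

text \<open>In the basis \<open>(1, \<alpha>), (1, \<beta>)\<close> of \<open>F \<times> F\<close> the set \<open>S\<close> becomes
  \<open>T = {(0, 0)} \<union> D \<times> {0} \<union> {0} \<times> (- D)\<close>. Fix a nontrivial additive character \<open>\<psi>\<close> of \<open>F\<close> and
  identify \<open>(c, d)\<close> with the character \<open>(x, y) \<mapsto> \<psi> (c x - d y)\<close>, whose sum over \<open>T\<close> is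
  \<open>1 + g c + g d\<close> for the Gauss periods \<open>g u = (\<Sum>x\<in>D. \<psi> (u x))\<close>. As \<open>D\<close> is a difference set
  and \<open>- 1\<close> is not a square, \<open>g\<close> takes two conjugate values off \<open>0\<close>, with real part \<open>- 1/2\<close> and
  squared modulus \<open>(q + 1)/4\<close>. So the squared modulus of the sum is \<open>q\<^sup>2\<close> at \<open>(0, 0)\<close>,
  \<open>q (q + 1)/4\<close> when exactly one of \<open>c, d\<close> vanishes, and otherwise \<open>q\<close> or \<open>0\<close> according to whether
  or not \<open>c\<close> and \<open>d\<close> lie in the same quadratic class. This is \<open>q\<close> times the number of
  representations of \<open>(c, d)\<close> as a difference of elements of \<open>T\<close>.\<close>

subsection \<open>Characters and difference counts\<close>

text \<open>Used for multiplication by squares, for negation, for the change of basis and for the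
  isomorphism onto the dual group.\<close>

lemma diff_count_iso:
  assumes "group G" "group H" "h \<in> iso G H" "S \<subseteq> carrier G" "g \<in> carrier G"
  shows "diff_count H (h ` S) (h g) = diff_count G S g"
proof -
  interpret G: group G by fact
  interpret H: group H by fact
  interpret h: group_hom G H h
    using assms(3) by unfold_locales (simp add: iso_def)
  have inj: "inj_on h (carrier G)"
    using assms(3) by (simp add: iso_iff)
  have eq: "h (x \<otimes>\<^bsub>G\<^esub> inv\<^bsub>G\<^esub> y) = h x \<otimes>\<^bsub>H\<^esub> inv\<^bsub>H\<^esub> h y"
    if "x \<in> S" "y \<in> S" for x y
    using that assms(4) by (simp add: subset_iff)
  have iff: "h x \<otimes>\<^bsub>H\<^esub> inv\<^bsub>H\<^esub> h y = h g \<longleftrightarrow> x \<otimes>\<^bsub>G\<^esub> inv\<^bsub>G\<^esub> y = g"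
    if "x \<in> S" "y \<in> S" for x y
  proof -
    have "x \<otimes>\<^bsub>G\<^esub> inv\<^bsub>G\<^esub> y \<in> carrier G"
      using that assms(4) by auto
    then show ?thesis
      using eq[OF that] inj_onD[OF inj, of "x \<otimes>\<^bsub>G\<^esub> inv\<^bsub>G\<^esub> y" g] assms(5) by auto
  qed
  have "{(\<phi>, \<psi>) \<in> h ` S \<times> h ` S. \<phi> \<otimes>\<^bsub>H\<^esub> inv\<^bsub>H\<^esub> \<psi> = h g} =
      map_prod h h ` {(x, y) \<in> S \<times> S. x \<otimes>\<^bsub>G\<^esub> inv\<^bsub>G\<^esub> y = g}"
    using iff by (force simp: image_iff)
  moreover have "inj_on (map_prod h h) {(x, y) \<in> S \<times> S. x \<otimes>\<^bsub>G\<^esub> inv\<^bsub>G\<^esub> y = g}"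
    by (rule inj_on_subset[OF map_prod_inj_on[OF inj inj]]) (use assms(4) in auto)
  ultimately show ?thesis
    unfolding diff_count_def by (simp only: card_image)
qed

lemma group_complex_units: "group complex_units"
proof (rule groupI)
  fix x assume "x \<in> carrier complex_units"
  then show "\<exists>y\<in>carrier complex_units. y \<otimes>\<^bsub>complex_units\<^esub> x = \<one>\<^bsub>complex_units\<^esub>"
    by (intro bexI[of _ "inverse x"]) (auto simp: complex_units_def)
qed (auto simp: complex_units_def)

context group
begin

lemma diff_count_inv:
  assumes "S \<subseteq> carrier G" "g \<in> carrier G"
  shows "diff_count G S (inv g) = diff_count G S g"
proof -
  have *: "x \<otimes> inv y = inv g \<longleftrightarrow> y \<otimes> inv x = g" if "x \<in> S" "y \<in> S" for x y
  proof -
    have "x \<in> carrier G" "y \<in> carrier G"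
      using that assms by auto
    then have "inv (y \<otimes> inv x) = x \<otimes> inv y" "y \<otimes> inv x \<in> carrier G"
      by (simp_all add: inv_mult_group)
    then show ?thesis
      using assms by (metis inv_inv)
  qed
  have "{(x, y) \<in> S \<times> S. x \<otimes> inv y = inv g} = prod.swap ` {(x, y) \<in> S \<times> S. x \<otimes> inv y = g}"
    using * by force
  then show ?thesis
    by (simp add: diff_count_def card_image)
qed

lemma diff_count_one:
  assumes "S \<subseteq> carrier G"
  shows "diff_count G S \<one> = card S"
proof -
  have "x \<otimes> inv y = \<one> \<longleftrightarrow> x = y" if "x \<in> S" "y \<in> S" for x y
    using that assms by (metis inv_closed inv_equality inv_inv r_inv subsetD)
  then have "{(x, y) \<in> S \<times> S. x \<otimes> inv y = \<one>} = (\<lambda>x. (x, x)) ` S"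
    by auto
  then show ?thesis
    by (simp add: diff_count_def card_image inj_on_def)
qed

text \<open>Pairs are grouped by their quotient. With \<open>f\<close> constant this counts all
  pairs; with \<open>f\<close> a character it is the squared modulus of a character sum.\<close>

lemma sum_quotients:
  fixes f :: "'a \<Rightarrow> complex"
  assumes "finite (carrier G)" "S \<subseteq> carrier G"
  shows "(\<Sum>x\<in>S. \<Sum>y\<in>S. f (x \<otimes> inv y)) = (\<Sum>g\<in>carrier G. of_nat (diff_count G S g) * f g)"
proof -
  have fin: "finite S"
    using assms finite_subset by blast
  have "(\<Sum>x\<in>S. \<Sum>y\<in>S. f (x \<otimes> inv y)) = (\<Sum>z\<in>S \<times> S. f (fst z \<otimes> inv (snd z)))"
    by (simp add: sum.cartesian_product case_prod_beta)
  also have "\<dots> = (\<Sum>g\<in>carrier G. \<Sum>z\<in>{z \<in> S \<times> S. fst z \<otimes> inv (snd z) = g}. f (fst z \<otimes> inv (snd z)))"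
    by (rule sum.group[symmetric]) (use assms fin in \<open>auto simp: subset_iff\<close>)
  also have "\<dots> = (\<Sum>g\<in>carrier G. of_nat (diff_count G S g) * f g)"
    unfolding diff_count_def by (intro sum.cong refl) (simp add: split_def mem_Times_iff)
  finally show ?thesis .
qed

lemma sum_diff_count:
  assumes "finite (carrier G)" "S \<subseteq> carrier G"
  shows "(\<Sum>g\<in>carrier G. diff_count G S g) = (card S)\<^sup>2"
proof -
  have "complex_of_nat (\<Sum>g\<in>carrier G. diff_count G S g) = complex_of_nat ((card S)\<^sup>2)"
    using sum_quotients[OF assms, of "\<lambda>_. 1"] by (simp add: power2_eq_square)
  then show ?thesis
    by (simp only: of_nat_eq_iff)
qed

lemma character_one: "\<chi> \<in> hom G complex_units \<Longrightarrow> \<chi> \<one> = 1"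
  using hom_one[OF _ is_group group_complex_units] by (simp add: complex_units_def)

lemma character_mult:
  "\<chi> \<in> hom G complex_units \<Longrightarrow> x \<in> carrier G \<Longrightarrow> y \<in> carrier G \<Longrightarrow> \<chi> (x \<otimes> y) = \<chi> x * \<chi> y"
  by (simp add: hom_def complex_units_def)

text \<open>By Lagrange, the value is a root of unity.\<close>

lemma norm_character:
  assumes "finite (carrier G)" "\<chi> \<in> hom G complex_units" "x \<in> carrier G"
  shows "norm (\<chi> x) = 1"
proof -
  have pow: "\<chi> (x [^] n) = \<chi> x ^ n" for n :: nat
    using assms by (induction n) (simp_all add: character_one character_mult)
  have "\<chi> x ^ order G = 1"
    using pow[of "order G"] assms by (simp add: pow_order_eq_1 character_one)
  moreover have "order G > 0"
    using assms by (simp add: order_gt_0_iff_finite)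
  ultimately show ?thesis
    by (metis norm_ge_zero norm_one norm_power power_eq_1_iff less_numeral_extra(3))
qed

lemma character_inv:
  assumes "finite (carrier G)" "\<chi> \<in> hom G complex_units" "x \<in> carrier G"
  shows "\<chi> (inv x) = cnj (\<chi> x)"
proof -
  have "\<chi> x * \<chi> (inv x) = 1"
    using assms by (metis character_mult character_one inv_closed r_inv)
  moreover have "\<chi> x * cnj (\<chi> x) = 1"
    using norm_character[OF assms] by (simp add: complex_norm_square[symmetric])
  ultimately show ?thesis
    by (metis mult_cancel_left mult_zero_left zero_neq_one)
qed

text \<open>Translation by \<open>a\<close> permutes the group but multiplies the sum by \<chi> a,
  which is not 1.\<close>

lemma sum_character_eq_0:
  assumes \<chi>: "\<chi> \<in> hom G complex_units" and a: "a \<in> carrier G" "\<chi> a \<noteq> 1"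
  shows "(\<Sum>x\<in>carrier G. \<chi> x) = 0"
proof -
  have "(\<Sum>x\<in>carrier G. \<chi> x) = (\<Sum>x\<in>carrier G. \<chi> (a \<otimes> x))"
    by (rule sum.reindex_bij_witness[of _ "\<lambda>x. a \<otimes> x" "\<lambda>x. inv a \<otimes> x"])
      (use a in \<open>auto simp: m_assoc[symmetric]\<close>)
  also have "\<dots> = \<chi> a * (\<Sum>x\<in>carrier G. \<chi> x)"
    using a by (simp add: character_mult[OF \<chi>] sum_distrib_left)
  finally show ?thesis
    using a(2) by simp
qed

text \<open>Conjugating a character value inverts its argument, so the squared modulus is a double
  sum over quotients: the Fourier transform of the difference count.\<close>

lemma norm_character_sum:
  assumes "finite (carrier G)" "\<chi> \<in> hom G complex_units" "S \<subseteq> carrier G"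
  shows "of_real ((norm (\<Sum>x\<in>S. \<chi> x))\<^sup>2) = (\<Sum>g\<in>carrier G. of_nat (diff_count G S g) * \<chi> g)"
proof -
  have "of_real ((norm (\<Sum>x\<in>S. \<chi> x))\<^sup>2) = (\<Sum>x\<in>S. \<chi> x) * cnj (\<Sum>x\<in>S. \<chi> x)"
    by (metis complex_norm_square of_real_power)
  also have "\<dots> = (\<Sum>x\<in>S. \<Sum>y\<in>S. \<chi> (x \<otimes> inv y))"
    using assms
    by (auto simp: sum_product character_mult character_inv subset_iff intro!: sum.cong)
  finally show ?thesis
    by (simp add: sum_quotients assms)
qed

end

text \<open>In a maximal proper subgroup \<open>H\<close> every coset is a power of a fixed one \<open>H #> x\<close>, so the
  exponent modulo the order of that coset defines a character.\<close>

lemma (in comm_group) ex_nontrivial_character: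
  assumes fin: "finite (carrier G)" and "carrier G \<noteq> {\<one>}"
  obtains \<chi> a where "\<chi> \<in> hom G complex_units" "a \<in> carrier G" "\<chi> a \<noteq> 1"
proof -
  define P where "P = {H. subgroup H G \<and> H \<noteq> carrier G}"
  have "P \<subseteq> Pow (carrier G)"
    unfolding P_def using subgroup.subset by blast
  then have "finite P"
    using fin finite_subset by blast
  moreover have "{\<one>} \<in> P"
    using assms triv_subgroup by (auto simp: P_def)
  ultimately obtain H where H: "H \<in> P" and max: "\<And>K. K \<in> P \<Longrightarrow> H \<subseteq> K \<Longrightarrow> H = K"
    by (metis empty_iff finite_has_maximal)
  interpret H: subgroup H G
    using H by (simp add: P_def)
  obtain x where x: "x \<in> carrier G" "x \<notin> H"
    using H H.subset by (auto simp: P_def)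
  \<comment> \<open>This says that the coset of \<open>y\<close> is the \<open>k\<close>-th power of
    the coset of \<open>x\<close>, without forming the quotient group.\<close>
  define e where "e y k \<longleftrightarrow> y \<otimes> inv (x [^] k) \<in> H" for y and k :: int
  have e_mult: "e (y \<otimes> z) (k + l)" if "e y k" "e z l" "y \<in> carrier G" "z \<in> carrier G" for y z k l
  proof -
    have "(y \<otimes> z) \<otimes> inv (x [^] (k + l)) = (y \<otimes> inv (x [^] k)) \<otimes> (z \<otimes> inv (x [^] l))"
      using that x by (simp add: int_pow_mult inv_mult m_ac)
    then show ?thesis
      using that unfolding e_def by simp
  qed
  have e_inv: "e (inv y) (- k)" if "e y k" "y \<in> carrier G" for y k
  proof -
    have "inv y \<otimes> inv (x [^] (- k)) = inv (y \<otimes> inv (x [^] k))"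
      using that x by (simp add: int_pow_neg inv_mult)
    then show ?thesis
      using that unfolding e_def by simp
  qed
  have e_H: "e y 0" if "y \<in> H" for y
    using that unfolding e_def by simp
  have e_x: "e x 1"
    using x by (simp add: e_def)
  \<comment> \<open>\<open>K\<close> is the subgroup generated by \<open>H\<close> and
    \<open>x\<close>. It is strictly larger than \<open>H\<close>, so by maximality it is the whole
    group and every \<open>y\<close> has an exponent.\<close>
  define K where "K = {y \<in> carrier G. \<exists>k. e y k}"
  have "subgroup K G"
  proof
    show "\<one> \<in> K"
      using e_H[of \<one>] by (auto simp: K_def)
  qed (use e_mult e_inv in \<open>auto simp: K_def, blast+\<close>)
  moreover have "H \<subseteq> K" "x \<in> K"
    using e_H e_x x H.subset by (auto simp: K_def)
  ultimately have "K = carrier G"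
    using max[of K] x by (auto simp: P_def)
  then have ex: "\<exists>k. e y k" if "y \<in> carrier G" for y
    using that by (auto simp: K_def)
  \<comment> \<open>The least such exponent \<open>n\<close> is the order of the coset of
    \<open>x\<close> in the quotient by \<open>H\<close>.\<close>
  define Q where "Q n \<longleftrightarrow> n > 0 \<and> x [^] n \<in> H" for n :: nat
  define n where "n = (LEAST n. Q n)"
  have "Q (order G)"
    using x fin by (simp add: Q_def pow_order_eq_1 order_gt_0_iff_finite)
  then have n: "Q n" and least: "\<And>k. Q k \<Longrightarrow> n \<le> k"
    unfolding n_def by (auto intro: LeastI Least_le)
  have "n > 0" "x [^] n \<in> H"
    using n by (auto simp: Q_def)
  \<comment> \<open>This is what makes \<chi> x differ from 1 at the end.\<close>
  have "n \<noteq> 1"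
    using \<open>x [^] n \<in> H\<close> x by auto
  \<comment> \<open>Otherwise the remainder of \<open>k\<close> modulo \<open>n\<close> would be a
    smaller positive exponent taking \<open>x\<close> into \<open>H\<close>.\<close>
  have dvd: "int n dvd k" if "x [^] k \<in> H" for k :: int
  proof -
    have "x [^] (k mod int n) = x [^] k \<otimes> inv ((x [^] n) [^] (k div int n))"
    proof -
      have "x [^] (k mod int n) = x [^] (k - int n * (k div int n))"
        by (simp add: minus_mult_div_eq_mod)
      also have "\<dots> = x [^] k \<otimes> inv (x [^] (int n * (k div int n)))"
        using x by (simp add: int_pow_diff)
      also have "x [^] (int n * (k div int n)) = (x [^] n) [^] (k div int n)"
        using x by (metis int_pow_int int_pow_pow)
      finally show ?thesis .
    qed
    moreover have "(x [^] n) [^] (k div int n) \<in> H"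
      using \<open>x [^] n \<in> H\<close> by (metis H.is_subgroup subgroup_int_pow_closed)
    ultimately have "x [^] (k mod int n) \<in> H"
      using that by simp
    then have "x [^] nat (k mod int n) \<in> H"
      using \<open>n > 0\<close> by (metis int_pow_int nat_0_le of_nat_0_less_iff pos_mod_sign)
    moreover have "nat (k mod int n) < n"
      using \<open>n > 0\<close> by (simp add: nat_less_iff)
    ultimately have "\<not> nat (k mod int n) > 0"
      using least[of "nat (k mod int n)"] by (auto simp: Q_def)
    then show ?thesis
      using \<open>n > 0\<close> by (metis dvd_eq_mod_eq_0 nat_0_iff neq0_conv order_antisym_conv
          of_nat_0_less_iff pos_mod_sign)
  qed
  have e_unique: "int n dvd k - l" if "e y k" "e y l" "y \<in> carrier G" for y k l
  proof -
    have "x [^] (k - l) = inv (y \<otimes> inv (x [^] k)) \<otimes> (y \<otimes> inv (x [^] l))"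
    proof -
      have "inv (y \<otimes> inv (x [^] k)) \<otimes> (y \<otimes> inv (x [^] l))
          = inv y \<otimes> (y \<otimes> (x [^] k \<otimes> inv (x [^] l)))"
        using x that inv_mult[of y "inv (x [^] k)"] by (simp add: m_ac)
      also have "\<dots> = x [^] k \<otimes> inv (x [^] l)"
        using x that by (simp add: m_assoc[symmetric])
      finally show ?thesis
        using x that by (simp add: int_pow_diff)
    qed
    then show ?thesis
      using that by (intro dvd) (simp add: e_def)
  qed
  \<comment> \<open>The powers of a primitive \<open>n\<close>-th root of unity.\<close>
  define w where "w k = cis (2 * pi * of_int k / of_nat n)" for k :: int
  have w_add: "w (k + l) = w k * w l" for k l
    unfolding w_def by (simp add: cis_mult add_divide_distrib distrib_left)
  have w_dvd: "w k = 1 \<longleftrightarrow> int n dvd k" for k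
  proof
    assume "w k = 1"
    then have "cos (2 * pi * of_int k / of_nat n) = 1"
      by (simp add: w_def complex_eq_iff)
    then obtain j :: int where "2 * pi * of_int k / of_nat n = of_int j * 2 * pi"
      by (auto simp: cos_one_2pi_int)
    then have "real_of_int k = real_of_int (j * int n)"
      using \<open>n > 0\<close> by (simp add: field_simps)
    then have "k = j * int n"
      by (simp only: of_int_eq_iff)
    then show "int n dvd k"
      by simp
  next
    assume "int n dvd k"
    then obtain j where "k = int n * j" ..
    then have "2 * pi * of_int k / of_nat n = 2 * pi * of_int j"
      using \<open>n > 0\<close> by simp
    then show "w k = 1"
      by (simp only: w_def cis_multiple_2pi Ints_of_int)
  qed
  \<comment> \<open>The choice made by \<open>SOME\<close> is harmless: by \<open>e_unique\<close>
    two exponents of \<open>y\<close> differ by a multiple of \<open>n\<close>, on which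
    \<open>w\<close> is 1.\<close>
  define \<chi> where "\<chi> y = w (SOME k. e y k)" for y
  have \<chi>: "\<chi> y = w k" if "e y k" "y \<in> carrier G" for y k
  proof -
    have "e y (SOME k. e y k)"
      using that by (auto intro: someI)
    then have "int n dvd (SOME k. e y k) - k"
      using e_unique that by blast
    then show ?thesis
      using w_add[of "(SOME k. e y k) - k" k] by (simp add: w_dvd[symmetric] \<chi>_def)
  qed
  have "\<chi> \<in> hom G complex_units"
  proof (rule homI)
    show "\<chi> y \<in> carrier complex_units" for y
      by (simp add: \<chi>_def w_def complex_units_def)
    fix y z assume yz: "y \<in> carrier G" "z \<in> carrier G"
    then obtain k l where "e y k" "e z l"
      using ex by metis
    with yz show "\<chi> (y \<otimes> z) = \<chi> y \<otimes>\<^bsub>complex_units\<^esub> \<chi> z"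
      using e_mult[of y k z l] \<chi> w_add by (simp add: complex_units_def)
  qed
  moreover have "\<chi> x \<noteq> 1"
    using \<chi>[OF e_x x(1)] \<open>n \<noteq> 1\<close> by (simp add: w_dvd)
  ultimately show thesis
    using that x by blast
qed

subsection \<open>Self dual pairings\<close>

text \<open>A symmetric nondegenerate bicharacter: multiplicativity is demanded in the second
  argument and passes to the first by symmetry. The last clause is the formal duality equation for
  two sets of equal size, where |S|^2 / |S| leaves the factor |S|.\<close>

definition self_dual_pairing :: "('a, 'm) monoid_scheme \<Rightarrow> ('a \<Rightarrow> 'a \<Rightarrow> complex) \<Rightarrow> 'a set \<Rightarrow> bool" where
  "self_dual_pairing G B S \<longleftrightarrow>
     (\<forall>x\<in>carrier G. B x \<in> hom G complex_units) \<and>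
     (\<forall>x\<in>carrier G. \<forall>y\<in>carrier G. B x y = B y x) \<and>
     (\<forall>x\<in>carrier G. (\<forall>y\<in>carrier G. B x y = 1) \<longrightarrow> x = \<one>\<^bsub>G\<^esub>) \<and>
     S \<subseteq> carrier G \<and> S \<noteq> {} \<and>
     (\<forall>g\<in>carrier G. (cmod (\<Sum>s\<in>S. B g s))\<^sup>2 = real (card S) * real (diff_count G S g))"

text \<open>Serves to carry the pairing found for the image set in convenient coordinates back to
  the original set.\<close>

lemma self_dual_pairing_iso:
  assumes "group G" "group H" "h \<in> iso G H" "S \<subseteq> carrier G"
    and "self_dual_pairing H B (h ` S)"
  shows "self_dual_pairing G (\<lambda>x y. B (h x) (h y)) S"
proof -
  interpret h: group_hom G H h
    using assms by (auto simp: group_hom_def group_hom_axioms_def iso_def)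
  have inj: "inj_on h (carrier G)" and surj: "h ` carrier G = carrier H"
    using assms(3) by (auto simp: iso_iff)
  have inj_S: "inj_on h S"
    using inj assms(4) inj_on_subset by blast
  note sd = assms(5)[unfolded self_dual_pairing_def]
  have "x = \<one>\<^bsub>G\<^esub>" if "x \<in> carrier G" "\<forall>y\<in>carrier G. B (h x) (h y) = 1" for x
  proof -
    have "h x = \<one>\<^bsub>H\<^esub>"
      using sd that surj by (metis h.hom_closed imageE)
    then show ?thesis
      using inj_onD[OF inj, of x "\<one>\<^bsub>G\<^esub>"] that by simp
  qed
  moreover have "(\<lambda>y. B (h x) (h y)) \<in> hom G complex_units" if "x \<in> carrier G" for x
    using sd that h.hom_closed by (auto simp: hom_def Pi_iff)
  moreover have "(cmod (\<Sum>s\<in>S. B (h g) (h s)))\<^sup>2 = real (card S) * real (diff_count G S g)"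
    if "g \<in> carrier G" for g
  proof -
    have "(cmod (\<Sum>s\<in>h ` S. B (h g) s))\<^sup>2 = real (card (h ` S)) * real (diff_count H (h ` S) (h g))"
      using sd that by auto
    then show ?thesis
      using diff_count_iso[OF assms(1-4) that] inj_S by (simp add: sum.reindex card_image)
  qed
  ultimately show ?thesis
    using sd assms(4) by (auto simp: self_dual_pairing_def)
qed

text \<open>The map from \<open>x\<close> to \<open>B x\<close> identifies the group with its dual:
  nondegeneracy gives injectivity, and orthogonality of characters gives surjectivity. Under this
  map the last clause of the pairing becomes formal duality.\<close>

lemma formally_self_dualI:
  fixes G (structure)
  assumes "comm_group G" and fin: "finite (carrier G)" and "self_dual_pairing G B S"
  shows "formally_self_dual G S"
proof -
  interpret comm_group G by fact
  interpret D: comm_group "dual_group G"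
    by (rule comm_group_dual_group) (rule is_group)
  note sd = assms(3)[unfolded self_dual_pairing_def]
  have hom: "B x \<in> hom G complex_units" if "x \<in> carrier G" for x
    using sd that by blast
  have sym: "B x y = B y x" if "x \<in> carrier G" "y \<in> carrier G" for x y
    using sd that by blast
  have nondeg: "\<exists>y\<in>carrier G. B x y \<noteq> 1" if "x \<in> carrier G" "x \<noteq> \<one>" for x
    using sd that by blast
  have S: "S \<subseteq> carrier G" "S \<noteq> {}"
    using sd by auto
  have mult_left: "B (x \<otimes> y) z = B x z * B y z"
    if "x \<in> carrier G" "y \<in> carrier G" "z \<in> carrier G" for x y z
    using that sym[of z] by (simp add: sym[of _ z] character_mult[OF hom])
  \<comment> \<open>Restriction to the carrier yields the extensional functions of which
    \<open>dual_group\<close> consists.\<close>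
  define \<Delta> where "\<Delta> x = (\<lambda>y\<in>carrier G. B x y)" for x
  have closed: "\<Delta> x \<in> carrier (dual_group G)" if "x \<in> carrier G" for x
    using hom[OF that] by (auto simp: \<Delta>_def dual_group_def hom_def)
  have \<Delta>_hom: "\<Delta> \<in> hom G (dual_group G)"
    by (rule homI) (auto simp: closed, auto simp: \<Delta>_def dual_group_def mult_left fun_eq_iff)
  interpret \<Delta>: group_hom G "dual_group G" \<Delta>
    by unfold_locales (rule \<Delta>_hom)
  have inj: "inj_on \<Delta> (carrier G)"
  proof (subst \<Delta>.inj_on_one_iff, intro allI impI)
    fix x assume x: "x \<in> carrier G" "\<Delta> x = \<one>\<^bsub>dual_group G\<^esub>"
    have "B x y = 1" if "y \<in> carrier G" for y
      using fun_cong[OF x(2), of y] that by (simp add: \<Delta>_def dual_group_def)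
    then show "x = \<one>"
      using nondeg x by metis
  qed
  have surj: "\<chi> \<in> \<Delta> ` carrier G" if \<chi>: "\<chi> \<in> carrier (dual_group G)" for \<chi>
  proof (rule ccontr)
    assume not: "\<chi> \<notin> \<Delta> ` carrier G"
    have \<chi>_hom: "\<chi> \<in> hom G complex_units" and \<chi>_ext: "\<chi> \<in> extensional (carrier G)"
      using \<chi> by (auto simp: dual_group_def)
    \<comment> \<open>Since \<chi> is missed by \<Delta>, it differs from \<Delta> (inv x), the
      inverse of \<Delta> x. Hence its product with \<open>B x\<close> is a nontrivial
      character.\<close>
    have 0: "(\<Sum>y\<in>carrier G. \<chi> y * B x y) = 0" if x: "x \<in> carrier G" for x
    proof -
      have "\<chi> \<noteq> \<Delta> (inv x)"
        using not x by (metis imageI inv_closed)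
      then obtain y where y: "y \<in> carrier G" "\<chi> y \<noteq> B (inv x) y"
        using \<chi>_ext by (metis \<Delta>_def extensionalityI restrict_apply restrict_extensional)
      have "B (inv x) y * B x y = 1"
        using x y mult_left[of "inv x" x y] sym[of \<one> y] character_one[OF hom[of y]] by simp
      then have "\<chi> y * B x y \<noteq> 1"
        using y by (metis mult_cancel_right mult_zero_right zero_neq_one)
      moreover have "(\<lambda>y. \<chi> y * B x y) \<in> hom G complex_units"
        using \<chi>_hom hom[OF x] by (auto simp: hom_def complex_units_def)
      ultimately show ?thesis
        using sum_character_eq_0 y by blast
    qed
    \<comment> \<open>Summed in the other order, only the term at the identity survives. It equals
      the group order, which is not 0.\<close>
    have "0 = (\<Sum>x\<in>carrier G. \<Sum>y\<in>carrier G. \<chi> y * B x y)"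
      using 0 by simp
    also have "\<dots> = (\<Sum>y\<in>carrier G. \<chi> y * (\<Sum>x\<in>carrier G. B y x))"
      by (subst sum.swap) (auto simp: sum_distrib_left sym intro!: sum.cong)
    also have "\<dots> = (\<Sum>y\<in>carrier G. if y = \<one> then of_nat (order G) else 0)"
    proof (rule sum.cong)
      fix y assume y: "y \<in> carrier G"
      show "\<chi> y * (\<Sum>x\<in>carrier G. B y x) = (if y = \<one> then of_nat (order G) else 0)"
      proof (cases "y = \<one>")
        case True
        have "B \<one> x = 1" if "x \<in> carrier G" for x
          using that sym[of \<one> x] character_one[OF hom] by simp
        then show ?thesis
          using True character_one[OF \<chi>_hom] by (simp add: order_def)
      next
        case False
        then show ?thesis
          using nondeg[OF y False] sum_character_eq_0[OF hom[OF y]] by auto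
      qed
    qed simp
    also have "\<dots> = of_nat (order G)"
      using fin by (simp add: sum.delta)
    finally show False
      using fin by (simp add: order_gt_0_iff_finite[symmetric])
  qed
  have iso: "\<Delta> \<in> iso G (dual_group G)"
    using inj surj closed by (auto simp: iso_iff \<Delta>_hom)
  have card: "card (\<Delta> ` S) = card S"
    using inj S by (metis card_image inj_on_subset)
  have "card S > 0"
    using S fin by (simp add: card_gt_0_iff finite_subset)
  have "(cmod (\<Sum>x\<in>S. \<chi> x))\<^sup>2 =
      (real (card S))\<^sup>2 / real (card (\<Delta> ` S)) * real (diff_count (dual_group G) (\<Delta> ` S) \<chi>)"
    if \<chi>: "\<chi> \<in> carrier (dual_group G)" for \<chi>
  proof -
    obtain g where g: "g \<in> carrier G" "\<chi> = \<Delta> g"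
      using surj[OF \<chi>] by auto
    have "(\<Sum>x\<in>S. \<Delta> g x) = (\<Sum>x\<in>S. B g x)"
      using S by (intro sum.cong) (auto simp: \<Delta>_def)
    moreover have "diff_count (dual_group G) (\<Delta> ` S) (\<Delta> g) = diff_count G S g"
      by (rule diff_count_iso) (auto simp: iso S g is_group D.is_group)
    ultimately show ?thesis
      using sd g card \<open>card S > 0\<close> by (simp add: power2_eq_square)
  qed
  then have "formally_dual_pair G S (\<Delta> ` S)"
    using S closed fin comm_group_axioms by (auto simp: formally_dual_pair_def)
  then show ?thesis
    using iso S by (auto simp: formally_self_dual_def formally_dual_pair_under_def)
qed

subsection \<open>Paley sets\<close>

text \<open>Writing q = 4k + 3 keeps the parameters free of division: (q - 1)/2 = 2k + 1 is the size
  of \<open>D\<close>, and (q + 1)/4 = k + 1 will be the constant difference count.\<close>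

locale paley_field = field R for R (structure) +
  fixes k :: nat
  assumes order_eq: "order R = 4 * k + 3"
begin

abbreviation "D \<equiv> paley_set R"
abbreviation "N \<equiv> (\<lambda>y. \<ominus> y) ` paley_set R"
abbreviation "\<nu> \<equiv> diff_count (add_monoid R)"

lemma fin: "finite (carrier R)"
  using order_eq by (simp add: order_def card_ge_0_finite)

lemma D_E:
  assumes "d \<in> D"
  obtains x where "x \<in> carrier R" "x \<noteq> \<zero>" "d = x [^] (2::nat)"
  using assms unfolding paley_set_def by blast

lemma inj_uminus: "inj_on (\<lambda>x. \<ominus> x) (carrier R)"
  by (metis inj_onI minus_minus)

text \<open>If 1 = -1, even multiples of 1 vanish, so the multiple by the odd number
  \<open>order R\<close> would be 1; but it is 0.\<close>

lemma one_neq_uminus_one: "\<one> \<noteq> \<ominus> \<one>"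
proof
  assume "\<one> = \<ominus> \<one>"
  then have "\<one> \<oplus> \<one> = \<zero>"
    by (metis one_closed r_neg)
  then have two: "[(2::nat)] \<cdot> \<one> = \<zero>"
    by (simp add: numeral_2_eq_2)
  have "order (add_monoid R) = 2 * (2 * k + 1) + 1"
    using order_eq by (simp add: order_def)
  then have "\<zero> = [(2 * (2 * k + 1) + 1)] \<cdot> \<one>"
    using add.pow_order_eq_1[of \<one>] fin by simp
  also have "\<dots> = [(2 * (2 * k + 1))] \<cdot> \<one> \<oplus> \<one>"
    by simp
  also have "[(2 * (2 * k + 1))] \<cdot> \<one> = \<zero>"
    by (metis two add.nat_pow_pow add.nat_pow_one one_closed)
  finally show False
    by simp
qed

lemma D_subset: "D \<subseteq> carrier R - {\<zero>}"
  by (auto simp: paley_set_def numeral_2_eq_2 integral_iff)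

lemma D_mult: "x \<in> D \<Longrightarrow> y \<in> D \<Longrightarrow> x \<otimes> y \<in> D"
  unfolding paley_set_def by (force simp: nat_pow_distrib[symmetric] integral_iff)

text \<open>Raise x^2 = -1 to the power 2k + 1. The left side becomes 1, because the multiplicative
  group has order 4k + 2, and the right side stays -1.\<close>

lemma uminus_one_notin_D: "\<ominus> \<one> \<notin> D"
proof
  assume "\<ominus> \<one> \<in> D"
  then obtain x where x: "x \<in> carrier R" "x \<noteq> \<zero>" "x [^] (2::nat) = \<ominus> \<one>"
    by (metis D_E)
  have sq: "\<ominus> \<one> [^] (2::nat) = \<one>"
    by (simp add: numeral_2_eq_2 l_minus r_minus)
  interpret M: group "Multiplicative_Group.mult_of R"
    by (rule field_mult_group)
  have order_eq': "order (Multiplicative_Group.mult_of R) = 2 * (2 * k + 1)"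
    using order_eq fin by (simp add: order_def)
  have "x [^] (2 * (2 * k + 1)) = \<one>"
    using M.pow_order_eq_1[of x] x fin order_eq'
    by (simp add: Multiplicative_Group.nat_pow_mult_of)
  also have "x [^] (2 * (2 * k + 1)) = \<ominus> \<one> [^] (2 * k + 1)"
    using x nat_pow_pow[of x 2 "2 * k + 1"] by simp
  also have "\<dots> = \<ominus> \<one>"
    using sq nat_pow_pow[of "\<ominus> \<one>" 2 k] by simp
  finally show False
    using one_neq_uminus_one by simp
qed

text \<open>If both y = x^2 and -y were nonzero squares, dividing -y by x^2 would make -1 a
  square.\<close>

lemma D_inter_N: "D \<inter> N = {}"
proof (rule ccontr)
  assume "D \<inter> N \<noteq> {}"
  then obtain y where y: "y \<in> D" "\<ominus> y \<in> D"
    by auto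
  then obtain x where x: "x \<in> carrier R" "x \<noteq> \<zero>" "y = x [^] (2::nat)"
    by (metis D_E)
  have inv: "inv x \<in> Units R"
    using x Units_inv_Units[of x] field_Units by simp
  then have "inv x \<otimes> inv x \<in> D"
    unfolding paley_set_def
    by (intro image_eqI[of _ _ "inv x"]) (auto simp: numeral_2_eq_2 field_Units)
  then have "\<ominus> y \<otimes> (inv x \<otimes> inv x) \<in> D"
    using y D_mult by blast
  moreover have "\<ominus> y \<otimes> (inv x \<otimes> inv x) = \<ominus> \<one>"
  proof -
    have u: "x \<in> Units R"
      using x by (simp add: field_Units)
    have "y \<otimes> (inv x \<otimes> inv x) = (x \<otimes> inv x) \<otimes> (x \<otimes> inv x)"
      using u x by (simp add: numeral_2_eq_2 m_ac)
    then show ?thesis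
      using u x by (simp add: l_minus)
  qed
  ultimately show False
    using uminus_one_notin_D by simp
qed

lemma square_eq_iff:
  assumes "x \<in> carrier R" "y \<in> carrier R"
  shows "x [^] (2::nat) = y [^] (2::nat) \<longleftrightarrow> x = y \<or> x = \<ominus> y"
proof
  assume "x [^] (2::nat) = y [^] (2::nat)"
  then have "(x \<oplus> y) \<otimes> (x \<ominus> y) = \<zero>"
    using assms by (simp add: numeral_2_eq_2) algebra
  then have "x \<oplus> y = \<zero> \<or> x \<ominus> y = \<zero>"
    using assms by (simp add: integral_iff)
  then show "x = y \<or> x = \<ominus> y"
    using assms by (metis add.inv_closed minus_equality r_right_minus_eq minus_minus)
next
  assume "x = y \<or> x = \<ominus> y"
  then show "x [^] (2::nat) = y [^] (2::nat)"
    using assms by (auto simp: numeral_2_eq_2 l_minus r_minus)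
qed

lemma uminus_neq: "x \<in> carrier R \<Longrightarrow> x \<noteq> \<zero> \<Longrightarrow> \<ominus> x \<noteq> x"
proof
  assume x: "x \<in> carrier R" "x \<noteq> \<zero>" and "\<ominus> x = x"
  then have "\<ominus> \<one> \<otimes> x = \<one> \<otimes> x"
    by (simp add: l_minus)
  then have "\<ominus> \<one> = \<one>"
    using x m_rcancel[of x "\<ominus> \<one>" \<one>] by simp
  then show False
    using one_neq_uminus_one by simp
qed

text \<open>Squaring is two-to-one on the 4k + 2 nonzero elements, with fibres {y, -y}.\<close>

lemma card_D: "card D = 2 * k + 1"
proof -
  have "card {x \<in> carrier R - {\<zero>}. x [^] (2::nat) = d} = 2" if d: "d \<in> D" for d
  proof -
    obtain y where y: "y \<in> carrier R" "y \<noteq> \<zero>" "d = y [^] (2::nat)"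
      using D_E[OF d] by blast
    have "{x \<in> carrier R - {\<zero>}. x [^] (2::nat) = d} = {y, \<ominus> y}"
      using y by (auto simp: square_eq_iff)
    then show ?thesis
      using uminus_neq[of y] y by simp
  qed
  then have "(\<Sum>x\<in>carrier R - {\<zero>}. 1) = (\<Sum>d\<in>D. 2 :: nat)"
    using fin by (subst sum.image_gen[where g = "\<lambda>x. x [^] (2::nat)"])
      (auto simp: paley_set_def intro!: sum.cong)
  then show ?thesis
    using fin order_eq by (simp add: order_def)
qed

lemma card_N: "card N = 2 * k + 1"
  using card_D D_subset by (subst card_image) (auto intro: inj_on_subset[OF inj_uminus])

lemma finD: "finite D" "finite N"
  using card_D card_N by (simp_all add: card_ge_0_finite)

lemma N_subset: "N \<subseteq> carrier R - {\<zero>}"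
  using D_subset by auto

lemma D_un_N: "D \<union> N = carrier R - {\<zero>}"
proof (rule card_subset_eq)
  have "finite D" "finite N"
    using card_D card_N by (simp_all add: card_ge_0_finite)
  then show "card (D \<union> N) = card (carrier R - {\<zero>})"
    using fin order_eq D_inter_N by (simp add: order_def card_Un_disjoint card_D card_N)
qed (use fin D_subset N_subset in auto)

lemma uminus_in_D_iff: "x \<in> carrier R \<Longrightarrow> \<ominus> x \<in> D \<longleftrightarrow> x \<in> N"
  using D_subset by (force simp: image_iff)

lemma uminus_in_N_iff: "x \<in> carrier R \<Longrightarrow> \<ominus> x \<in> N \<longleftrightarrow> x \<in> D"
  by (metis uminus_in_D_iff minus_minus add.inv_closed)

section \<open>Difference counts of the Paley set with zero adjoined\<close>

lemma D_times_D:
  assumes "u \<in> D"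
  shows "(\<otimes>) u ` D = D"
proof (rule card_subset_eq)
  show "finite D"
    using card_D by (simp add: card_ge_0_finite)
  show "card ((\<otimes>) u ` D) = card D"
    using assms D_subset by (intro card_image) (auto simp: inj_on_def subset_iff m_lcancel)
qed (use assms D_mult in auto)

lemma mult_iso:
  assumes "u \<in> carrier R - {\<zero>}"
  shows "(\<otimes>) u \<in> iso (add_monoid R) (add_monoid R)"
proof -
  have inj: "inj_on ((\<otimes>) u) (carrier R)"
    using assms by (auto simp: inj_on_def m_lcancel)
  moreover have "(\<otimes>) u ` carrier R = carrier R"
    using assms by (intro endo_inj_surj inj fin) auto
  ultimately show ?thesis
    using assms by (auto simp: iso_iff hom_def r_distr)
qed

lemma uminus_iso: "(\<lambda>x. \<ominus> x) \<in> iso (add_monoid R) (add_monoid R)"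
proof -
  have "(\<lambda>x. \<ominus> x) ` carrier R = carrier R"
    by (auto simp: image_iff) (metis minus_minus add.inv_closed)
  then show ?thesis
    by (auto simp: iso_iff hom_def minus_add inj_uminus add.m_comm)
qed

text \<open>Multiplication by a square preserves the set, and a count is unchanged under negation of
  \<open>c\<close>; as \<open>c\<close> or its negative is a square, the count is constant off zero.
  The total over all \<open>c\<close> is (2k + 2)^2, of which 2k + 2 falls to zero, and (2k + 2)(2k
  + 1) = (4k + 2)(k + 1). Zero is adjoined because \<open>T\<close> meets the first axis in this
  set.\<close>

lemma diff_count_insert_D:
  assumes "c \<in> carrier R - {\<zero>}"
  shows "\<nu> (insert \<zero> D) c = k + 1"
proof -
  let ?E = "insert \<zero> D"
  have E: "?E \<subseteq> carrier R"
    using D_subset by auto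
  have inD: "\<nu> ?E c = \<nu> ?E \<one>" if "c \<in> D" for c
  proof -
    have c: "c \<in> carrier R - {\<zero>}"
      using that D_subset by auto
    then have "(\<otimes>) c ` ?E = ?E"
      using D_times_D[OF that] by simp
    then show ?thesis
      using diff_count_iso[OF add.is_group add.is_group mult_iso[OF c], of ?E \<one>] E c by simp
  qed
  have const: "\<nu> ?E c = \<nu> ?E \<one>" if "c \<in> carrier R - {\<zero>}" for c
  proof (cases "c \<in> D")
    case False
    then have "\<ominus> c \<in> D"
      using that D_un_N uminus_in_D_iff by auto
    then show ?thesis
      using inD add.diff_count_inv[of ?E c] E that by simp
  qed (rule inD)
  have cardE: "card ?E = 2 * k + 2"
    using card_D D_subset by (subst card_insert_disjoint) (auto simp: card_ge_0_finite)
  have "(2 * k + 2)\<^sup>2 = (\<Sum>c\<in>carrier R. \<nu> ?E c)"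
    using add.sum_diff_count[of ?E] fin E cardE by simp
  also have "\<dots> = \<nu> ?E \<zero> + (\<Sum>c\<in>carrier R - {\<zero>}. \<nu> ?E c)"
    using fin by (simp add: sum.remove)
  also have "\<nu> ?E \<zero> = 2 * k + 2"
    using add.diff_count_one[of ?E] E cardE by simp
  also have "(\<Sum>c\<in>carrier R - {\<zero>}. \<nu> ?E c) = (\<Sum>c\<in>carrier R - {\<zero>}. \<nu> ?E \<one>)"
    by (intro sum.cong refl const)
  also have "\<dots> = (4 * k + 2) * \<nu> ?E \<one>"
    using fin order_eq by (simp add: order_def)
  finally have "(4 * k + 2) * \<nu> ?E \<one> = (4 * k + 2) * (k + 1)"
    by (simp add: power2_eq_square algebra_simps)
  then have "\<nu> ?E \<one> = k + 1"
    by (simp only: mult_cancel1) simp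
  then show ?thesis
    using const[OF assms] by simp
qed

lemma diff_count_insert_N:
  assumes "c \<in> carrier R - {\<zero>}"
  shows "\<nu> (insert \<zero> N) c = k + 1"
proof -
  have "\<nu> ((\<lambda>x. \<ominus> x) ` insert \<zero> D) (\<ominus> (\<ominus> c)) = \<nu> (insert \<zero> D) (\<ominus> c)"
    using assms D_subset by (intro diff_count_iso add.is_group uminus_iso) auto
  then show ?thesis
    using assms diff_count_insert_D[of "\<ominus> c"] by simp
qed

section \<open>Gauss periods\<close>

definition period :: "('a \<Rightarrow> complex) \<Rightarrow> 'a \<Rightarrow> complex" where
  "period \<psi> u = (\<Sum>x\<in>D. \<psi> (u \<otimes> x))"

context
  fixes \<psi> a
  assumes \<psi>: "\<psi> \<in> hom (add_monoid R) complex_units" and a: "a \<in> carrier R" "\<psi> a \<noteq> 1"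
begin

lemma period_zero: "period \<psi> \<zero> = of_nat (2 * k + 1)"
proof -
  have "period \<psi> \<zero> = (\<Sum>x\<in>D. 1)"
    unfolding period_def using D_subset add.character_one[OF \<psi>] by (intro sum.cong) auto
  then show ?thesis
    by (simp add: card_D)
qed

lemma period_D:
  assumes "u \<in> D"
  shows "period \<psi> u = (\<Sum>x\<in>D. \<psi> x)"
proof -
  have "inj_on ((\<otimes>) u) D"
    using assms D_subset by (auto simp: inj_on_def subset_iff m_lcancel)
  then have "(\<Sum>x\<in>(\<otimes>) u ` D. \<psi> x) = period \<psi> u"
    by (simp add: sum.reindex period_def)
  then show ?thesis
    using D_times_D[OF assms] by simp
qed

lemma period_N:
  assumes "u \<in> N"
  shows "period \<psi> u = cnj (\<Sum>x\<in>D. \<psi> x)"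
proof -
  obtain v where v: "v \<in> D" "u = \<ominus> v"
    using assms by auto
  have "\<psi> (u \<otimes> x) = cnj (\<psi> (v \<otimes> x))" if "x \<in> D" for x
    using v that D_subset add.character_inv[OF _ \<psi>, of "v \<otimes> x"] fin by (auto simp: l_minus subset_iff)
  then have "period \<psi> u = cnj (period \<psi> v)"
    by (simp add: period_def)
  then show ?thesis
    using period_D[OF v(1)] by simp
qed

text \<open>The sums over \<open>D\<close> and \<open>N\<close> are conjugate and add up to -1,
  which gives the real part. If P is the sum over \<open>D\<close>, the constant difference count
  gives |1 + P|^2 = (2k + 2) - (k + 1) = k + 1, and subtracting (1/2)^2 leaves the square of the
  imaginary part. Its sign stays open; only the square enters later.\<close>

lemma Re_period: "Re (\<Sum>x\<in>D. \<psi> x) = - 1 / 2"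
  and Im_period: "(Im (\<Sum>x\<in>D. \<psi> x))\<^sup>2 = of_nat k + 3 / 4"
proof -
  let ?E = "insert \<zero> D" and ?P = "\<Sum>x\<in>D. \<psi> x"
  have \<psi>0: "\<psi> \<zero> = 1"
    using add.character_one[OF \<psi>] by simp
  have N: "(\<Sum>x\<in>N. \<psi> x) = cnj ?P"
  proof -
    have "inj_on (\<lambda>x. \<ominus> x) D"
      using D_subset by (auto intro: inj_on_subset[OF inj_uminus])
    then have "(\<Sum>x\<in>N. \<psi> x) = (\<Sum>x\<in>D. \<psi> (\<ominus> x))"
      by (simp add: sum.reindex)
    also have "\<dots> = (\<Sum>x\<in>D. cnj (\<psi> x))"
      using D_subset add.character_inv[OF _ \<psi>] fin by (intro sum.cong) auto
    finally show ?thesis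
      by simp
  qed
  have sum0: "(\<Sum>x\<in>carrier R. \<psi> x) = 0"
    using add.sum_character_eq_0[OF \<psi>] a by simp
  then have nz: "(\<Sum>x\<in>carrier R - {\<zero>}. \<psi> x) = - 1"
    using fin by (simp add: sum_diff1 \<psi>0)
  then have "?P + cnj ?P = - 1"
    using N sum.union_disjoint[OF finD D_inter_N, of \<psi>] D_un_N by simp
  then have "Re (?P + cnj ?P) = Re (- 1)"
    by (rule arg_cong)
  then show re: "Re ?P = - 1 / 2"
    by simp
  have cardE: "card ?E = 2 * k + 2"
    using card_D D_subset finD by (subst card_insert_disjoint) auto
  have \<nu>0: "\<nu> ?E \<zero> = 2 * k + 2"
    using add.diff_count_one[of ?E] D_subset cardE by auto
  have "of_real ((cmod (\<Sum>x\<in>?E. \<psi> x))\<^sup>2) = (\<Sum>c\<in>carrier R. of_nat (\<nu> ?E c) * \<psi> c)"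
    using add.norm_character_sum[OF _ \<psi>, of ?E] D_subset fin by auto
  also have "\<dots> = of_nat (2 * k + 2) + (\<Sum>c\<in>carrier R - {\<zero>}. of_nat (\<nu> ?E c) * \<psi> c)"
    using fin by (simp add: sum.remove[of _ \<zero>] \<nu>0 \<psi>0)
  also have "(\<Sum>c\<in>carrier R - {\<zero>}. of_nat (\<nu> ?E c) * \<psi> c) = of_nat (k + 1) * - 1"
    unfolding nz[symmetric] sum_distrib_left
    by (intro sum.cong) (auto simp: diff_count_insert_D)
  also have "(\<Sum>x\<in>?E. \<psi> x) = 1 + ?P"
    using D_subset finD by (subst sum.insert) (auto simp: \<psi>0)
  finally have "complex_of_real ((cmod (1 + ?P))\<^sup>2) = of_real (of_nat (k + 1))"
    by simp
  then have "(cmod (1 + ?P))\<^sup>2 = of_nat (k + 1)"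
    by (simp only: of_real_eq_iff)
  then show "(Im ?P)\<^sup>2 = of_nat k + 3 / 4"
    using re unfolding cmod_power2 by (simp add: power2_eq_square)
qed

end

section \<open>The set \<open>T\<close> on the two axes and its self dual pairing\<close>

abbreviation "G \<equiv> add_monoid R \<times>\<times> add_monoid R"

definition T :: "('a \<times> 'a) set" where
  "T = {(\<zero>, \<zero>)} \<union> D \<times> {\<zero>} \<union> {\<zero>} \<times> N"

lemma group_G: "group G"
  by (intro DirProd_group add.is_group)

lemma comm_group_G: "comm_group G"
  by (rule group.group_comm_groupI[OF group_G]) (auto simp: add.m_comm)

lemma T_subset: "T \<subseteq> carrier R \<times> carrier R"
  using D_subset N_subset by (auto simp: T_def)

lemma sum_over_T: "(\<Sum>t\<in>T. f t) = f (\<zero>, \<zero>) + (\<Sum>x\<in>D. f (x, \<zero>)) + (\<Sum>y\<in>N. f (\<zero>, y))"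
proof -
  have "finite ({(\<zero>, \<zero>)} \<union> D \<times> {\<zero>})" "finite ({\<zero>} \<times> N)" "finite (D \<times> {\<zero>})"
    using finD by simp_all
  moreover have "({(\<zero>, \<zero>)} \<union> D \<times> {\<zero>}) \<inter> ({\<zero>} \<times> N) = {}" "(\<zero>, \<zero>) \<notin> D \<times> {\<zero>}"
    using D_subset N_subset by auto
  ultimately have "(\<Sum>t\<in>T. f t) = f (\<zero>, \<zero>) + (\<Sum>t\<in>D \<times> {\<zero>}. f t) + (\<Sum>t\<in>{\<zero>} \<times> N. f t)"
    unfolding T_def by (simp add: sum.union_disjoint Groups.add.assoc)
  then show ?thesis
    by (simp add: sum.cartesian_product')
qed

lemma card_T: "card T = order R"
  unfolding card_eq_sum sum_over_T using order_eq card_D card_N by simp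

lemma diff_count_minus:
  "\<nu> S c = card {(x, y) \<in> S \<times> S. x \<ominus> y = c}"
  by (simp add: diff_count_def a_minus_def a_inv_def)

lemma diff_count_G:
  assumes "S \<subseteq> carrier R \<times> carrier R"
  shows "diff_count G S (c, d) =
    card {(s, t) \<in> S \<times> S. fst s \<ominus> fst t = c \<and> snd s \<ominus> snd t = d}"
proof -
  have "s \<otimes>\<^bsub>G\<^esub> inv\<^bsub>G\<^esub> t = (fst s \<ominus> fst t, snd s \<ominus> snd t)" if "s \<in> S" "t \<in> S" for s t
  proof -
    obtain x y x' y' where s: "s = (x, y)" "t = (x', y')"
      by (metis surj_pair)
    then have "x' \<in> carrier R" "y' \<in> carrier R"
      using that assms by auto
    then show ?thesis
      using s inv_DirProd[OF add.is_group add.is_group, of x' y']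
      by (simp add: a_minus_def a_inv_def)
  qed
  then have "{(s, t) \<in> S \<times> S. s \<otimes>\<^bsub>G\<^esub> inv\<^bsub>G\<^esub> t = (c, d)} =
      {(s, t) \<in> S \<times> S. fst s \<ominus> fst t = c \<and> snd s \<ominus> snd t = d}"
    by auto
  then show ?thesis
    by (simp add: diff_count_def)
qed

text \<open>As \<open>c\<close> is nonzero, one of the two points has nonzero first coordinate and
  so lies on the first axis. The second coordinates agree, so the other point lies there too, and
  the count reduces to that of \<open>insert \<zero> D\<close>.\<close>

lemma diff_count_T_left:
  assumes "c \<in> carrier R - {\<zero>}"
  shows "diff_count G T (c, \<zero>) = k + 1"
proof -
  have "{(s, t) \<in> T \<times> T. fst s \<ominus> fst t = c \<and> snd s \<ominus> snd t = \<zero>} =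
      (\<lambda>(x, y). ((x, \<zero>), (y, \<zero>))) ` {(x, y) \<in> insert \<zero> D \<times> insert \<zero> D. x \<ominus> y = c}"
    using D_subset N_subset assms by (fastforce simp: T_def minus_eq)
  then show ?thesis
    using diff_count_insert_D[OF assms] T_subset
    by (simp add: diff_count_G diff_count_minus card_image inj_on_def)
qed

lemma diff_count_T_right:
  assumes "d \<in> carrier R - {\<zero>}"
  shows "diff_count G T (\<zero>, d) = k + 1"
proof -
  have "{(s, t) \<in> T \<times> T. fst s \<ominus> fst t = \<zero> \<and> snd s \<ominus> snd t = d} =
      (\<lambda>(x, y). ((\<zero>, x), (\<zero>, y))) ` {(x, y) \<in> insert \<zero> N \<times> insert \<zero> N. x \<ominus> y = d}"
    using D_subset N_subset assms by (fastforce simp: T_def minus_eq)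
  then show ?thesis
    using diff_count_insert_N[OF assms] T_subset
    by (simp add: diff_count_G diff_count_minus card_image inj_on_def)
qed

text \<open>The two points must lie on different axes, so the only candidates are (c, 0) - (0, -d)
  and (0, d) - (-c, 0). The first needs \<open>c\<close> and \<open>d\<close> in \<open>D\<close>,
  the second needs both in \<open>N\<close>.\<close>

lemma diff_count_T_both:
  assumes "c \<in> carrier R - {\<zero>}" "d \<in> carrier R - {\<zero>}"
  shows "diff_count G T (c, d) = (if c \<in> D \<longleftrightarrow> d \<in> D then 1 else 0)"
proof -
  have cd: "c \<in> carrier R" "c \<noteq> \<zero>" "d \<in> carrier R" "d \<noteq> \<zero>"
    using assms by auto
  have T_E: "(\<exists>x \<in> insert \<zero> D. t = (x, \<zero>)) \<or> (\<exists>y \<in> insert \<zero> N. t = (\<zero>, y))" if "t \<in> T" for t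
    using that by (auto simp: T_def)
  have in_carrier: "x \<in> carrier R" if "x \<in> insert \<zero> D \<or> x \<in> insert \<zero> N" for x
    using that D_subset N_subset by blast
  have "(s, t) \<in> T \<times> T \<and> fst s \<ominus> fst t = c \<and> snd s \<ominus> snd t = d \<longleftrightarrow>
      s = (c, \<zero>) \<and> t = (\<zero>, \<ominus> d) \<and> c \<in> D \<and> d \<in> D \<or>
      s = (\<zero>, d) \<and> t = (\<ominus> c, \<zero>) \<and> c \<in> N \<and> d \<in> N" (is "?L \<longleftrightarrow> ?R") for s t
  proof
    assume L: ?L
    then consider
      (1) x x' where "s = (x, \<zero>)" "t = (x', \<zero>)" |
      (2) x y where "x \<in> insert \<zero> D" "s = (x, \<zero>)" "y \<in> insert \<zero> N" "t = (\<zero>, y)" |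
      (3) x y where "x \<in> insert \<zero> D" "t = (x, \<zero>)" "y \<in> insert \<zero> N" "s = (\<zero>, y)" |
      (4) y y' where "s = (\<zero>, y)" "t = (\<zero>, y')"
      using T_E[of s] T_E[of t] by blast
    then show ?R
    proof cases
      case 1
      then show ?thesis
        using L cd by (simp add: minus_eq)
    next
      case 2
      then have "x \<in> carrier R" "y \<in> carrier R"
        using in_carrier by blast+
      then have "x = c" "y = \<ominus> d"
        using L 2 by (auto simp: minus_eq)
      then show ?thesis
        using 2 cd uminus_in_N_iff[of d] by auto
    next
      case 3
      then have "x \<in> carrier R" "y \<in> carrier R"
        using in_carrier by blast+
      then have "y = d" "x = \<ominus> c"
        using L 3 by (auto simp: minus_eq)
      then show ?thesis
        using 3 cd uminus_in_D_iff[of c] by auto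
    next
      case 4
      then show ?thesis
        using L cd by (simp add: minus_eq)
    qed
  next
    assume ?R
    then show ?L
      using cd uminus_in_D_iff[of c] uminus_in_N_iff[of d]
      by (elim disjE conjE) (simp_all add: T_def minus_eq)
  qed
  then have eq: "{(s, t) \<in> T \<times> T. fst s \<ominus> fst t = c \<and> snd s \<ominus> snd t = d} =
      {(s, t). s = (c, \<zero>) \<and> t = (\<zero>, \<ominus> d) \<and> c \<in> D \<and> d \<in> D \<or>
        s = (\<zero>, d) \<and> t = (\<ominus> c, \<zero>) \<and> c \<in> N \<and> d \<in> N}"
    by auto
  have "c \<in> N \<longleftrightarrow> c \<notin> D" "d \<in> N \<longleftrightarrow> d \<notin> D"
    using D_un_N D_inter_N assms by auto
  then have "{(s, t) \<in> T \<times> T. fst s \<ominus> fst t = c \<and> snd s \<ominus> snd t = d} =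
      (if c \<in> D then if d \<in> D then {((c, \<zero>), (\<zero>, \<ominus> d))} else {}
       else if d \<in> D then {} else {((\<zero>, d), (\<ominus> c, \<zero>))})"
    unfolding eq by auto
  then show ?thesis
    using T_subset by (simp add: diff_count_G)
qed

text \<open>The sign in the pairing turns the sum over \<open>N\<close> into a period over \<open>D\<close>.\<close>

lemma self_dual_pairing_T:
  assumes \<psi>: "\<psi> \<in> hom (add_monoid R) complex_units" and a: "a \<in> carrier R" "\<psi> a \<noteq> 1"
  shows "self_dual_pairing G (\<lambda>(c, d) (x, y). \<psi> (c \<otimes> x \<ominus> d \<otimes> y)) T"
proof -
  let ?B = "\<lambda>(c, d) (x, y). \<psi> (c \<otimes> x \<ominus> d \<otimes> y)" and ?P = "\<Sum>x\<in>D. \<psi> x"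
  have \<psi>0: "\<psi> \<zero> = 1"
    using add.character_one[OF \<psi>] by simp
  have hom: "?B g \<in> hom G complex_units" if "g \<in> carrier G" for g
  proof (cases g)
    case (Pair c d)
    have "\<psi> (c \<otimes> (x \<oplus> x') \<ominus> d \<otimes> (y \<oplus> y')) = \<psi> (c \<otimes> x \<ominus> d \<otimes> y) * \<psi> (c \<otimes> x' \<ominus> d \<otimes> y')"
      if "x \<in> carrier R" "y \<in> carrier R" "x' \<in> carrier R" "y' \<in> carrier R" for x y x' y'
    proof -
      have "c \<otimes> (x \<oplus> x') \<ominus> d \<otimes> (y \<oplus> y') = (c \<otimes> x \<ominus> d \<otimes> y) \<oplus> (c \<otimes> x' \<ominus> d \<otimes> y')"
        using that \<open>g \<in> carrier G\<close> Pair by (simp add: r_distr) algebra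
      then show ?thesis
        using that \<open>g \<in> carrier G\<close> Pair add.character_mult[OF \<psi>] by simp
    qed
    then show ?thesis
      using \<psi> that Pair by (auto simp: hom_def complex_units_def)
  qed
  have nondeg: "g = \<one>\<^bsub>G\<^esub>" if g: "g \<in> carrier G" "\<forall>h\<in>carrier G. ?B g h = 1" for g
  proof (cases g)
    case (Pair c d)
    then have cd: "c \<in> carrier R" "d \<in> carrier R"
      using g by auto
    have "c = \<zero>"
    proof (rule ccontr)
      assume "c \<noteq> \<zero>"
      then have c: "c \<in> Units R"
        using cd field_Units by simp
      then have "c \<otimes> (inv c \<otimes> a) = a"
        using cd a by (simp add: m_assoc[symmetric])
      \<comment> \<open>The test element is chosen so that the pairing returns \<psi> a; for
        \<open>d\<close> below, the extra sign cancels the minus in the pairing.\<close>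
      moreover have "\<psi> (c \<otimes> (inv c \<otimes> a) \<ominus> d \<otimes> \<zero>) = 1"
        using g(2)[rule_format, of "(inv c \<otimes> a, \<zero>)"] Pair c a by simp
      ultimately show False
        using a cd by (simp add: minus_eq)
    qed
    moreover have "d = \<zero>"
    proof (rule ccontr)
      assume "d \<noteq> \<zero>"
      then have d: "d \<in> Units R"
        using cd field_Units by simp
      then have "d \<otimes> (inv d \<otimes> \<ominus> a) = \<ominus> a"
        using cd a by (simp add: m_assoc[symmetric])
      moreover have "\<psi> (c \<otimes> \<zero> \<ominus> d \<otimes> (inv d \<otimes> \<ominus> a)) = 1"
        using g(2)[rule_format, of "(\<zero>, inv d \<otimes> \<ominus> a)"] Pair d a by simp
      ultimately show False
        using a cd by (simp add: minus_eq)
    qed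
    ultimately show ?thesis
      using Pair by simp
  qed
  have sum_T: "(\<Sum>t\<in>T. ?B (c, d) t) = 1 + period \<psi> c + period \<psi> d"
    if cd: "c \<in> carrier R" "d \<in> carrier R" for c d
  proof -
    have "(\<Sum>t\<in>T. ?B (c, d) t)
        = 1 + (\<Sum>x\<in>D. \<psi> (c \<otimes> x \<ominus> d \<otimes> \<zero>)) + (\<Sum>y\<in>N. \<psi> (c \<otimes> \<zero> \<ominus> d \<otimes> y))"
      using cd by (simp add: sum_over_T minus_eq \<psi>0)
    also have "(\<Sum>x\<in>D. \<psi> (c \<otimes> x \<ominus> d \<otimes> \<zero>)) = period \<psi> c"
      unfolding period_def using cd D_subset by (intro sum.cong) (auto simp: minus_eq)
    also have "(\<Sum>y\<in>N. \<psi> (c \<otimes> \<zero> \<ominus> d \<otimes> y)) = (\<Sum>x\<in>D. \<psi> (c \<otimes> \<zero> \<ominus> d \<otimes> \<ominus> x))"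
      using D_subset by (subst sum.reindex) (auto intro: inj_on_subset[OF inj_uminus])
    also have "\<dots> = period \<psi> d"
      unfolding period_def using cd D_subset
      by (intro sum.cong) (auto simp: minus_eq r_minus subset_iff)
    finally show ?thesis .
  qed
  define y where "y = Im ?P"
  have y: "y * y = of_nat k + 3 / 4"
    using Im_period[OF \<psi> a] by (simp add: y_def power2_eq_square)
  \<comment> \<open>This is 4 y^2 = 4k + 3, shaped as a rewrite rule for the case analysis
    below.\<close>
  have y4: "y * (y * 4) = 3 + real k * 4"
    using y by (simp add: field_simps)
  have per_D: "Re (period \<psi> u) = - 1 / 2" "Im (period \<psi> u) = y" if "u \<in> D" for u
    using Re_period[OF \<psi> a] period_D[OF \<psi> a that] by (simp_all add: y_def)
  have per_N: "Re (period \<psi> u) = - 1 / 2" "Im (period \<psi> u) = - y" if "u \<in> N" for u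
    unfolding period_N[OF \<psi> a that] using Re_period[OF \<psi> a] by (simp_all add: y_def sum_negf)
  have norm: "(cmod (\<Sum>t\<in>T. ?B g t))\<^sup>2 = real (card T) * real (diff_count G T g)"
    if "g \<in> carrier G" for g
  proof (cases g)
    case (Pair c d)
    then have cd: "c \<in> carrier R" "d \<in> carrier R"
      using that by auto
    have cases: "x = \<zero> \<or> x \<in> D \<and> x \<noteq> \<zero> \<or> x \<in> N \<and> x \<notin> D \<and> x \<noteq> \<zero>" if "x \<in> carrier R" for x
      using that D_un_N D_subset N_subset D_inter_N by blast
    have zero: "diff_count G T (\<zero>, \<zero>) = 4 * k + 3"
      using group.diff_count_one[OF group_G, of T] T_subset order_eq by (simp add: card_T)
    \<comment> \<open>Nine cases. Two zeros give (4k + 3)^2. One zero gives (2k + 3/2)^2 + y^2 = (4k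
      + 3)(k + 1). With no zero the real part cancels, and the imaginary part is 2y or -2y for equal
      classes and 0 for different ones.\<close>
    have "(cmod (1 + period \<psi> c + period \<psi> d))\<^sup>2 = real (4 * k + 3) * real (diff_count G T (c, d))"
      unfolding cmod_power2 using cases[OF cd(1)] cases[OF cd(2)] cd
      by (elim disjE) (simp_all add: zero diff_count_T_left diff_count_T_right diff_count_T_both
          period_zero[OF \<psi> a] per_D per_N y y4 power2_eq_square algebra_simps)
    then show ?thesis
      using Pair sum_T[OF cd] order_eq by (simp add: card_T)
  qed
  show ?thesis
    unfolding self_dual_pairing_def
    using hom nondeg norm T_subset by (auto simp: T_def m_comm)
qed

section \<open>Change of basis\<close>

lemma ex_coordinates:
  assumes \<alpha>: "\<alpha> \<in> carrier R" and \<beta>: "\<beta> \<in> carrier R" and "\<alpha> \<noteq> \<beta>"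
    and S: "S = {(\<zero>, \<zero>)} \<union> {(x, \<alpha> \<otimes> x) | x. x \<in> D} \<union> {(x, \<beta> \<otimes> x) | x. x \<in> N}"
  obtains h where "h \<in> iso G G" "h ` S = T" "S \<subseteq> carrier G"
proof -
  \<comment> \<open>Up to sign, the inverse of the determinant of the basis (1, \<alpha>), (1,
    \<beta>).\<close>
  define \<gamma> where "\<gamma> = inv (\<alpha> \<ominus> \<beta>)"
  have "\<alpha> \<ominus> \<beta> \<noteq> \<zero>"
    using assms by (simp add: r_right_minus_eq)
  then have \<gamma>: "\<gamma> \<in> carrier R" "\<gamma> \<otimes> (\<alpha> \<ominus> \<beta>) = \<one>"
    using \<alpha> \<beta> field_Units unfolding \<gamma>_def by simp_all
  \<comment> \<open>\<open>e\<close> builds a vector from its coordinates in this basis, and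
    \<open>h\<close> recovers the coordinates by Cramer's rule.\<close>
  define e where "e = (\<lambda>(c, d). (c \<oplus> d, \<alpha> \<otimes> c \<oplus> \<beta> \<otimes> d))"
  define h where "h = (\<lambda>(x, y). (\<gamma> \<otimes> (y \<ominus> \<beta> \<otimes> x), \<gamma> \<otimes> (\<alpha> \<otimes> x \<ominus> y)))"
  have he: "h (e t) = t" if "t \<in> carrier R \<times> carrier R" for t
  proof (cases t)
    case (Pair c d)
    then have cd: "c \<in> carrier R" "d \<in> carrier R"
      using that by auto
    have "(\<alpha> \<otimes> c \<oplus> \<beta> \<otimes> d) \<ominus> \<beta> \<otimes> (c \<oplus> d) = (\<alpha> \<ominus> \<beta>) \<otimes> c"
      "\<alpha> \<otimes> (c \<oplus> d) \<ominus> (\<alpha> \<otimes> c \<oplus> \<beta> \<otimes> d) = (\<alpha> \<ominus> \<beta>) \<otimes> d"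
      using cd \<alpha> \<beta> by algebra+
    then show ?thesis
      using cd \<alpha> \<beta> \<gamma> Pair by (simp add: h_def e_def m_assoc[symmetric])
  qed
  have eh: "e (h t) = t" if "t \<in> carrier R \<times> carrier R" for t
  proof (cases t)
    case (Pair x y)
    then have xy: "x \<in> carrier R" "y \<in> carrier R"
      using that by auto
    have "\<gamma> \<otimes> (y \<ominus> \<beta> \<otimes> x) \<oplus> \<gamma> \<otimes> (\<alpha> \<otimes> x \<ominus> y) = \<gamma> \<otimes> (\<alpha> \<ominus> \<beta>) \<otimes> x"
      "\<alpha> \<otimes> (\<gamma> \<otimes> (y \<ominus> \<beta> \<otimes> x)) \<oplus> \<beta> \<otimes> (\<gamma> \<otimes> (\<alpha> \<otimes> x \<ominus> y)) = \<gamma> \<otimes> (\<alpha> \<ominus> \<beta>) \<otimes> y"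
      using xy \<alpha> \<beta> \<gamma>(1) by algebra+
    then show ?thesis
      using xy \<gamma> Pair by (simp add: h_def e_def)
  qed
  have h_closed: "h t \<in> carrier R \<times> carrier R" if "t \<in> carrier R \<times> carrier R" for t
    using that \<alpha> \<beta> \<gamma>(1) by (auto simp: h_def)
  have e_closed: "e t \<in> carrier R \<times> carrier R" if "t \<in> carrier R \<times> carrier R" for t
    using that \<alpha> \<beta> by (auto simp: e_def)
  have "h \<in> hom G G"
  proof (rule homI)
    fix s t assume "s \<in> carrier G" "t \<in> carrier G"
    moreover obtain x y x' y' where st: "s = (x, y)" "t = (x', y')"
      by (metis surj_pair)
    ultimately have c: "x \<in> carrier R" "y \<in> carrier R" "x' \<in> carrier R" "y' \<in> carrier R"
      by auto
    have "\<gamma> \<otimes> (y \<oplus> y' \<ominus> \<beta> \<otimes> (x \<oplus> x')) = \<gamma> \<otimes> (y \<ominus> \<beta> \<otimes> x) \<oplus> \<gamma> \<otimes> (y' \<ominus> \<beta> \<otimes> x')"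
      "\<gamma> \<otimes> (\<alpha> \<otimes> (x \<oplus> x') \<ominus> (y \<oplus> y')) = \<gamma> \<otimes> (\<alpha> \<otimes> x \<ominus> y) \<oplus> \<gamma> \<otimes> (\<alpha> \<otimes> x' \<ominus> y')"
      using c \<alpha> \<beta> \<gamma>(1) by algebra+
    then show "h (s \<otimes>\<^bsub>G\<^esub> t) = h s \<otimes>\<^bsub>G\<^esub> h t"
      using st by (simp add: h_def)
  qed (use h_closed in simp)
  moreover have "bij_betw h (carrier R \<times> carrier R) (carrier R \<times> carrier R)"
    by (intro bij_betw_byWitness[of _ e] ballI image_subsetI he eh h_closed e_closed)
  ultimately have iso: "h \<in> iso G G"
    by (simp add: iso_def)
  have S_T: "S = e ` T"
  proof -
    have "e ` T = {e (\<zero>, \<zero>)} \<union> (\<lambda>x. e (x, \<zero>)) ` D \<union> (\<lambda>x. e (\<zero>, x)) ` N"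
      by (auto simp: T_def)
    also have "\<dots> = {(\<zero>, \<zero>)} \<union> (\<lambda>x. (x, \<alpha> \<otimes> x)) ` D \<union> (\<lambda>x. (x, \<beta> \<otimes> x)) ` N"
      using \<alpha> \<beta> D_subset N_subset
      by (intro arg_cong2[of _ _ _ _ "(\<union>)"] image_cong) (auto simp: e_def)
    finally show ?thesis
      unfolding S by blast
  qed
  have "h ` S = T"
    unfolding S_T image_image using he T_subset by (force simp: subset_iff)
  moreover have "S \<subseteq> carrier G"
    unfolding S_T carrier_DirProd partial_object.simps using e_closed T_subset by blast
  ultimately show thesis
    using that iso by blast
qed

end

theorem theorem3p9:
  fixes R :: "('a, 'r) ring_scheme" (structure)
    and p m :: nat
    and \<alpha> \<beta> :: 'a
  assumes "Factorial_Ring.prime p" and "m \<ge> 1" and "p ^ m mod 4 = 3"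
    and "field R" and "order R = p ^ m"
    and "\<alpha> \<in> prime_subfield R - {\<zero>}" and "\<beta> \<in> prime_subfield R - {\<zero>}" and "\<alpha> \<noteq> \<beta>"
  shows "formally_self_dual (add_monoid R \<times>\<times> add_monoid R)
           ({(\<zero>, \<zero>)} \<union> {(x, \<alpha> \<otimes> x) | x. x \<in> paley_set R}
              \<union> {(x, \<beta> \<otimes> x) | x. x \<in> (\<lambda>y. \<ominus> y) ` paley_set R})"
    (is "formally_self_dual ?G ?S")
proof -
  interpret field R by fact
  \<comment> \<open>The congruence modulo 4 supplies the parameter \<open>k\<close> of the
    locale.\<close>
  have "order R = 4 * (order R div 4) + 3"
    using assms by (metis div_mult_mod_eq mult.commute)
  then interpret paley_field R "order R div 4"
    by unfold_locales
  have "\<alpha> \<in> carrier R" "\<beta> \<in> carrier R"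
    using assms by (auto simp: prime_subfield_def)
  then obtain h where h: "h \<in> iso ?G ?G" "h ` ?S = T" "?S \<subseteq> carrier ?G"
    using ex_coordinates[OF _ _ \<open>\<alpha> \<noteq> \<beta>\<close> refl] by blast
  have "carrier R \<noteq> {\<zero>}"
    using one_closed one_not_zero by (metis singletonD)
  then obtain \<psi> a where "\<psi> \<in> hom (add_monoid R) complex_units" "a \<in> carrier R" "\<psi> a \<noteq> 1"
    using add.ex_nontrivial_character fin by auto
  \<comment> \<open>The pairing lives on the coordinates; composing with \<open>h\<close> in both
    arguments transfers it to the original set.\<close>
  then have "self_dual_pairing ?G (\<lambda>(c, d) (x, y). \<psi> (c \<otimes> x \<ominus> d \<otimes> y)) (h ` ?S)"
    unfolding h(2) by (rule self_dual_pairing_T)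
  then show ?thesis
    using self_dual_pairing_iso[OF group_G group_G h(1) h(3)]
    by (intro formally_self_dualI comm_group_G) (auto simp: fin)
qed

end
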